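(* Let $X,Y$ be sets with equivalence relations $R_X$ on $X$ and $R_Y$ on $Y$, with quotient maps $q_X:X\to X/R_X$ and $q_Y:Y\to Y/R_Y$. Let $K:X\to\mathcal{D}(Y)$ be an $(R_X,R_Y)$-compatible kernel. Then the formula $$\overline K([x])=(q_Y)_{\#}(K(x)),\qquad x\in X,$$ gives a well-defined and unique kernel $\overline K:X/R_X\to\mathcal{D}(Y/R_Y)$. Moreover, for every $\mu\in\mathcal{D}(X)$, $$(q_Y)_{\#}\bigl(K^{\dagger}(\mu)\bigr)=\overline K^{\dagger}\bigl((q_X)_{\#}\mu\bigr).$$
   Context: For a set $X$, $\mathcal{D}(X)$ denotes the set of finitely supported probability distributions on $X$. A kernel from $X$ to $Y$ is a function $K:X\to\mathcal{D}(Y)$; its affine extension $K^{\dagger}:\mathcal{D}(X)\to\mathcal{D}(Y)$ is $K^{\dagger}(\mu)(y)=\sum_x\mu(x)K(x)(y)$. For a map $f:X\to Y$ and $\mu\in\mathcal{D}(X)$, $f_{\#}\mu$ is the pushforward distribution. $[x]$ denotes the equivalence class of $x$. For an equivalence relation $R_Y$ on $Y$ with quotient map $q_Y$ and $\mu,\nu\in\mathcal{D}(Y)$, write $\mu\,\overline{R_Y}\,\nu$ iff $\mu(E)=\nu(E)$ for every class $E\in Y/R_Y$, equivalently $(q_Y)_{\#}\mu=(q_Y)_{\#}\nu$. A kernel $K:X\to\mathcal{D}(Y)$ is $(R_X,R_Y)$-compatible when $x\,R_X\,x'$ implies $K(x)\,\overline{R_Y}\,K(x')$. *)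

theory Defs
  imports "HOL-Probability.Probability_Mass_Function"
begin

definition fin_dist :: "'a set \<Rightarrow> 'a pmf set" where
  "fin_dist X = {\<mu>. finite (set_pmf \<mu>) \<and> set_pmf \<mu> \<subseteq> X}"

(* Kernels are extensional (equal to undefined off X), so that equality of
   kernels is equality of functions on X. *)
definition kernels :: "'a set \<Rightarrow> 'b set \<Rightarrow> ('a \<Rightarrow> 'b pmf) set" where
  "kernels X Y = X \<rightarrow>\<^sub>E fin_dist Y"

definition affine_ext :: "('a \<Rightarrow> 'b pmf) \<Rightarrow> 'a pmf \<Rightarrow> 'b pmf" where
  "affine_ext K \<mu> = bind_pmf \<mu> K"

lemma pmf_affine_ext:
  assumes "\<mu> \<in> fin_dist X"
  shows "pmf (affine_ext K \<mu>) y = (\<Sum>x\<in>set_pmf \<mu>. pmf \<mu> x * pmf (K x) y)"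
  using assms
  by (simp add: affine_ext_def fin_dist_def pmf_bind integral_measure_pmf_real[of "set_pmf \<mu>"]
      mult.commute)

lemma affine_ext_in_fin_dist:
  assumes "K \<in> kernels X Y" "\<mu> \<in> fin_dist X"
  shows "affine_ext K \<mu> \<in> fin_dist Y"
  using assms by (fastforce simp: affine_ext_def fin_dist_def kernels_def PiE_iff)

definition quot_map :: "('a \<times> 'a) set \<Rightarrow> 'a \<Rightarrow> 'a set" where
  "quot_map R x = R `` {x}"

definition dist_rel :: "'b set \<Rightarrow> ('b \<times> 'b) set \<Rightarrow> 'b pmf \<Rightarrow> 'b pmf \<Rightarrow> bool" where
  "dist_rel Y R \<mu> \<nu> \<longleftrightarrow> (\<forall>E \<in> Y // R. measure_pmf.prob \<mu> E = measure_pmf.prob \<nu> E)"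

definition compatible_kernel ::
    "('a \<times> 'a) set \<Rightarrow> 'b set \<Rightarrow> ('b \<times> 'b) set \<Rightarrow> ('a \<Rightarrow> 'b pmf) \<Rightarrow> bool" where
  "compatible_kernel RX Y RY K \<longleftrightarrow> (\<forall>(x, x') \<in> RX. dist_rel Y RY (K x) (K x'))"

end

theory Submission
  imports Defs
begin

text \<open>The fibre of the quotient map over a class is the class itself, so distributions on
  \<open>Y\<close> that agree on all classes have the same pushforward to \<open>Y // RY\<close>
  (\<open>map_pmf_quot_map_eqI\<close>). By compatibility, the pushforward of \<open>K x\<close>
  thus depends only on the class of \<open>x\<close>. It therefore factors through
  \<open>quot_map RX\<close>, uniquely because that map is onto \<open>X // RX\<close>. The final
  identity is formal: both sides average the pushforwards of \<open>K x\<close> over \<mu>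
  (\<open>map_pmf_affine_ext\<close>).\<close>

lemma vimage_quot_map:
  assumes "equiv Y R" and "E \<in> Y // R"
  shows "quot_map R -` {E} = E"
proof -
  obtain y where y: "y \<in> Y" "E = R `` {y}"
    using assms(2) by (rule quotientE)
  have "R `` {z} = R `` {y} \<longleftrightarrow> (y, z) \<in> R" for z
  proof
    assume "R `` {z} = R `` {y}"
    then show "(y, z) \<in> R"
      using eq_equiv_class[OF _ assms(1) y(1), of z] equivE[OF assms(1)] by (blast dest: symD)
  next
    assume "(y, z) \<in> R"
    then show "R `` {z} = R `` {y}"
      using equiv_class_eq[OF assms(1)] by simp
  qed
  then show ?thesis
    by (auto simp: quot_map_def y(2))
qed

text \<open>Compare point masses. At a class \<open>E\<close> the mass is the probability of the
  fibre, which is \<open>E\<close>; elsewhere both masses vanish because the supports lie in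
  \<open>Y\<close>.\<close>

lemma map_pmf_quot_map_eqI:
  assumes "equiv Y R" and "set_pmf \<mu> \<subseteq> Y" and "set_pmf \<nu> \<subseteq> Y" and "dist_rel Y R \<mu> \<nu>"
  shows "map_pmf (quot_map R) \<mu> = map_pmf (quot_map R) \<nu>"
proof (rule pmf_eqI)
  fix E
  show "pmf (map_pmf (quot_map R) \<mu>) E = pmf (map_pmf (quot_map R) \<nu>) E"
  proof (cases "E \<in> Y // R")
    case True
    then show ?thesis
      using assms(4) by (simp add: pmf_map vimage_quot_map[OF assms(1)] dist_rel_def)
  next
    case False
    then have "E \<notin> set_pmf (map_pmf (quot_map R) \<mu>)" "E \<notin> set_pmf (map_pmf (quot_map R) \<nu>)"
      using assms(2,3) by (auto simp: quot_map_def quotientI)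
    then show ?thesis
      by (simp only: set_pmf_iff not_not)
  qed
qed

lemma map_pmf_quot_map_in_fin_dist:
  assumes "\<mu> \<in> fin_dist Y"
  shows "map_pmf (quot_map R) \<mu> \<in> fin_dist (Y // R)"
  using assms by (auto simp: fin_dist_def quot_map_def quotientI)

text \<open>By the monad laws both sides are binds of \<mu>, so the two kernels need to agree only
  on its support.\<close>

lemma map_pmf_affine_ext:
  assumes "\<And>x. x \<in> set_pmf \<mu> \<Longrightarrow> map_pmf g (K x) = L (f x)"
  shows "map_pmf g (affine_ext K \<mu>) = affine_ext L (map_pmf f \<mu>)"
  unfolding affine_ext_def map_bind_pmf bind_map_pmf
  using assms by (intro bind_pmf_cong) auto

theorem theorem1:
  fixes X :: "'a set" and Y :: "'b set"
    and RX :: "('a \<times> 'a) set" and RY :: "('b \<times> 'b) set"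
    and K :: "'a \<Rightarrow> 'b pmf"
  assumes "equiv X RX" and "equiv Y RY"
    and "K \<in> kernels X Y"
    and "compatible_kernel RX Y RY K"
  shows "(\<forall>x\<in>X. \<forall>x'\<in>X. quot_map RX x = quot_map RX x' \<longrightarrow>
            map_pmf (quot_map RY) (K x) = map_pmf (quot_map RY) (K x'))
       \<and> (\<exists>!Kbar. Kbar \<in> kernels (X // RX) (Y // RY) \<and>
            (\<forall>x\<in>X. Kbar (quot_map RX x) = map_pmf (quot_map RY) (K x)))
       \<and> (\<forall>Kbar \<in> kernels (X // RX) (Y // RY).
            (\<forall>x\<in>X. Kbar (quot_map RX x) = map_pmf (quot_map RY) (K x)) \<longrightarrow>
            (\<forall>\<mu> \<in> fin_dist X.
               map_pmf (quot_map RY) (affine_ext K \<mu>)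
                 = affine_ext Kbar (map_pmf (quot_map RX) \<mu>)))"
proof -
  let ?q = "quot_map RX" and ?p = "map_pmf (quot_map RY)"
  have K: "K x \<in> fin_dist Y" if "x \<in> X" for x
    using assms(3) that by (auto simp: kernels_def)
  have wd: "?p (K x) = ?p (K x')" if "x \<in> X" "x' \<in> X" "?q x = ?q x'" for x x'
  proof (rule map_pmf_quot_map_eqI[OF assms(2)])
    have "(x, x') \<in> RX"
      using assms(1) that by (simp add: quot_map_def eq_equiv_class)
    then show "dist_rel Y RY (K x) (K x')"
      using assms(4) by (auto simp: compatible_kernel_def)
  qed (use K that in \<open>auto simp: fin_dist_def\<close>)
  let ?P = "\<lambda>L. L \<in> kernels (X // RX) (Y // RY) \<and> (\<forall>x\<in>X. L (?q x) = ?p (K x))"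
  have repr: "\<exists>x\<in>X. E = ?q x" if "E \<in> X // RX" for E
    using that by (auto simp: quotient_def quot_map_def)
  have "\<exists>!L. ?P L"
  proof (rule ex_ex1I)
    \<comment> \<open>A choice of representatives; \<open>wd\<close> makes the resulting value
      independent of it.\<close>
    define r where "r E = (SOME x. x \<in> X \<and> E = ?q x)" for E
    \<comment> \<open>The restriction to \<open>X // RX\<close> provides the extensionality that
      \<open>kernels\<close> demands.\<close>
    define L where "L = (\<lambda>E\<in>X // RX. ?p (K (r E)))"
    have r: "r E \<in> X" "E = ?q (r E)" if "E \<in> X // RX" for E
      using someI_ex[of "\<lambda>x. x \<in> X \<and> E = ?q x"] repr[OF that] unfolding r_def by auto
    have "L \<in> kernels (X // RX) (Y // RY)"
      using r K by (auto simp: L_def kernels_def intro!: map_pmf_quot_map_in_fin_dist)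
    moreover have "L (?q x) = ?p (K x)" if "x \<in> X" for x
    proof -
      have q: "?q x \<in> X // RX"
        using that by (simp add: quot_map_def quotientI)
      show ?thesis
        using wd[OF r(1)[OF q] that r(2)[OF q, symmetric]] q by (simp add: L_def)
    qed
    ultimately show "\<exists>L. ?P L"
      by blast
  next
    fix L L'
    assume L: "?P L" "?P L'"
    \<comment> \<open>Every class is some \<open>?q x\<close>, where the formula fixes the value;
      off \<open>X // RX\<close> both kernels are \<open>undefined\<close>.\<close>
    have "L E = L' E" if "E \<in> X // RX" for E
      using L repr[OF that] by auto
    then show "L = L'"
      using L unfolding kernels_def by (blast intro: PiE_ext)
  qed
  moreover have "?p (affine_ext K \<mu>) = affine_ext L (map_pmf ?q \<mu>)"
    if "?P L" "\<mu> \<in> fin_dist X" for L \<mu>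
    using that by (intro map_pmf_affine_ext) (auto simp: fin_dist_def)
  ultimately show ?thesis
    using wd by blast
qed

end
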